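(* Let $K=\mathbb{F}_{2^n}$ be the finite field with $2^n$ elements. Then $K\in\mathcal{N}_{2,2}$ for all $n\geq 2$ and $K\in\mathcal{N}_{2,3}$ for all $n\geq 1$.
   Context: For $f\in K[x]$, $f^i$ denotes the $i$-th iterate of $f$ under composition. For $k\ge 2$, $f$ has a newly reducible $k$th iterate over $K$ if $f^{k-1}$ is irreducible over $K$ but $f^k$ is not irreducible over $K$. Write $K\in\mathcal{N}_{2,k}$ if there exists at least one $f\in K[x]$ of degree $2$ with newly reducible $k$th iterate over $K$. *)

theory Defs
  imports "HOL-Library.Cardinality" "HOL-Computational_Algebra.Polynomial_Factorial"
begin

primrec poly_iterate :: "'a::comm_semiring_1 poly \<Rightarrow> nat \<Rightarrow> 'a poly" where
  "poly_iterate f 0 = [:0, 1:]"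
| "poly_iterate f (Suc i) = pcompose f (poly_iterate f i)"

definition newly_reducible_iterate :: "nat \<Rightarrow> 'a::field poly \<Rightarrow> bool" where
  "newly_reducible_iterate k f \<longleftrightarrow>
     k \<ge> 2 \<and> irreducible (poly_iterate f (k - 1)) \<and> \<not> irreducible (poly_iterate f k)"

text \<open>The field \<open>K\<close> is the type \<open>'a\<close>: \<open>newly_reducible_class TYPE('a) d k\<close>
  expresses that \<open>K\<close> belongs to the class \<open>N\<^sub>d\<^sub>,\<^sub>k\<close>.\<close>

definition newly_reducible_class :: "'a::field itself \<Rightarrow> nat \<Rightarrow> nat \<Rightarrow> bool" where
  "newly_reducible_class K d k \<longleftrightarrow>
     (\<exists>f :: 'a poly. degree f = d \<and> newly_reducible_iterate k f)"

end

theory Submission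
  imports Defs
begin

text \<open>
  Over a finite field \<open>K\<close> of characteristic \<open>2\<close>, consider quadratics of the form
  \<open>f = (x\<^sup>2 + x + w) / t\<close>. By Artin-Schreier theory \<open>f\<close> is irreducible iff the absolute trace of
  \<open>w\<close> is \<open>1\<close>. If \<open>f\<close> is irreducible with root \<open>\<alpha>\<close>, then \<open>f\<^sup>2\<close> is irreducible iff \<open>f - \<alpha>\<close> is irreducible
  over \<open>K(\<alpha>)\<close>, and transitivity of the trace turns this into the condition that \<open>t\<close> has trace
  \<open>1\<close>. One step further, for a root \<open>\<beta>\<close> of an irreducible \<open>f\<^sup>2\<close>, the relevant trace from \<open>K(\<beta>)\<close> is the trace
  from \<open>K(\<alpha>)\<close> of an element of \<open>K\<close>, hence \<open>0\<close>: the third iterate is always reducible.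
  So \<open>f\<close> has a newly reducible second iterate when \<open>w\<close> has trace \<open>1\<close> and \<open>t\<close> has trace \<open>0\<close>, and
  a newly reducible third iterate when both have trace \<open>1\<close>. In the first case \<open>t\<close> must be nonzero
  of trace \<open>0\<close>, which requires more than two elements.

  The proof below stays inside \<open>K\<close>. Trace \<open>0\<close> means being a value of \<open>x \<mapsto> x\<^sup>2 + x\<close>; the image
  of this map is a subgroup of index two (\<open>artin_schreier_index_2\<close>). The factors of the reducible
  iterates are written down explicitly (\<open>second_iterate_factorization\<close>,
  \<open>third_iterate_factorization\<close>). Their coefficients depend on the solution of an
  Artin-Schreier equation; in each case there are two candidate equations, whose right-hand sides
  differ by an element outside the image, so that one of them is solvable. For the third iterate
  the choice \<open>w = t\<close> keeps the factors simple, and irreducibility of the second iterate is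
  checked by comparing coefficients with a product of two quadratics.
\<close>

section \<open>Irreducibility over a field\<close>

text \<open>
  Of two factors, one has at most half the degree, and it can be made monic.
\<close>

lemma irreducible_if_no_small_monic_divisor:
  fixes p :: "'a::field poly"
  assumes deg: "degree p > 0"
    and nodiv: "\<And>q. lead_coeff q = 1 \<Longrightarrow> 0 < degree q \<Longrightarrow> 2 * degree q \<le> degree p \<Longrightarrow> \<not> q dvd p"
  shows "irreducible p"
proof (rule irreducibleI)
  show p0: "p \<noteq> 0" using deg by auto
  show "\<not> p dvd 1" using deg p0 by (simp add: is_unit_iff_degree)
  have unit: "a dvd 1" if ab: "p = a * b" and le: "degree a \<le> degree b" for a b
  proof (rule ccontr)
    assume nu: "\<not> a dvd 1"
    from ab p0 have a0: "a \<noteq> 0" and b0: "b \<noteq> 0" by auto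
    let ?q = "smult (inverse (lead_coeff a)) a"
    have "lead_coeff ?q = 1" using a0 by simp
    moreover have "0 < degree ?q" using a0 nu by (simp add: is_unit_iff_degree)
    moreover have "2 * degree ?q \<le> degree p"
      using ab le a0 b0 by (simp add: degree_mult_eq)
    moreover have "?q dvd p" using ab a0 by (simp add: smult_dvd_iff)
    ultimately show False using nodiv by blast
  qed
  fix a b assume ab: "p = a * b"
  show "a dvd 1 \<or> b dvd 1"
  proof (cases "degree a \<le> degree b")
    case True then show ?thesis using unit ab by blast
  next
    case False then show ?thesis using unit[of b a] ab by (simp add: mult.commute)
  qed
qed

lemma monic_degree_1E:
  assumes "lead_coeff (q :: 'a::field poly) = 1" "degree q = 1"
  obtains r where "q = [:-r, 1:]"
proof -
  have "q = [:- (- coeff q 0), 1:]"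
    using assms by (intro poly_eqI) (auto simp: coeff_pCons coeff_eq_0 split: nat.split)
  then show ?thesis by (rule that)
qed

lemma degree_le_2_eq:
  assumes "degree (q :: 'a::zero poly) \<le> 2"
  shows "q = [:coeff q 0, coeff q 1, coeff q 2:]"
  using assms
  by (intro poly_eqI) (auto simp: coeff_pCons coeff_eq_0 numeral_2_eq_2 split: nat.split)

lemma irreducible_quadratic:
  fixes p :: "'a::field poly"
  assumes "degree p = 2" and "\<And>x. poly p x \<noteq> 0"
  shows "irreducible p"
proof (rule irreducible_if_no_small_monic_divisor)
  fix q :: "'a poly"
  assume q: "lead_coeff q = 1" "0 < degree q" "2 * degree q \<le> degree p"
  then have "degree q = 1" using assms(1) by simp
  then obtain r where "q = [:-r, 1:]" using q(1) monic_degree_1E by blast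
  then show "\<not> q dvd p" using assms(2)[of r] by (simp add: poly_eq_0_iff_dvd)
qed (simp add: assms(1))

text \<open>
  The vanishing cubic coefficient forces the linear coefficients of two monic quadratic factors to
  be opposite.
\<close>

lemma irreducible_depressed_quartic:
  fixes c\<^sub>0 c\<^sub>1 c\<^sub>2 :: "'a::field"
  assumes noroot: "\<And>x. poly [:c\<^sub>0, c\<^sub>1, c\<^sub>2, 0, 1:] x \<noteq> 0"
    and nofac: "\<And>u v w. [:c\<^sub>0, c\<^sub>1, c\<^sub>2, 0, 1:] \<noteq> [:v, u, 1:] * [:w, -u, 1:]"
  shows "irreducible [:c\<^sub>0, c\<^sub>1, c\<^sub>2, 0, 1:]" (is "irreducible ?p")
proof (rule irreducible_if_no_small_monic_divisor)
  fix q :: "'a poly"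
  assume q: "lead_coeff q = 1" "0 < degree q" "2 * degree q \<le> degree ?p"
  show "\<not> q dvd ?p"
  proof (cases "degree q = 1")
    case True
    then obtain r where "q = [:-r, 1:]" using q(1) monic_degree_1E by blast
    then show ?thesis using noroot[of r] by (simp only: poly_eq_0_iff_dvd) simp
  next
    case False
    then have dq: "degree q = 2" using q by simp
    show ?thesis
    proof
      assume "q dvd ?p"
      then obtain r where r: "?p = q * r" by (elim dvdE)
      have nz: "q \<noteq> 0" "r \<noteq> 0" using r by auto
      have "degree ?p = degree q + degree r" unfolding r using nz by (rule degree_mult_eq)
      then have dr: "degree r = 2" using dq by simp
      obtain a\<^sub>0 a\<^sub>1 where qq: "q = [:a\<^sub>0, a\<^sub>1, 1:]"
        using degree_le_2_eq[of q] q(1) dq by force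
      obtain b\<^sub>0 b\<^sub>1 b\<^sub>2 where rr: "r = [:b\<^sub>0, b\<^sub>1, b\<^sub>2:]"
        using degree_le_2_eq[of r] dr by force
      have "b\<^sub>2 = 1" "b\<^sub>1 = - a\<^sub>1"
        using r by (auto simp: qq rr eq_neg_iff_add_eq_0)
      then show False using nofac[of a\<^sub>0 a\<^sub>1 b\<^sub>0] r by (simp add: qq rr)
    qed
  qed
qed simp

section \<open>The Artin-Schreier map in characteristic two\<close>

text \<open>
  Translation by \<open>1\<close> permutes the field, so the sum of all elements equals itself plus the
  cardinality; hence the cardinality vanishes in the field.
\<close>

lemma two_eq_0_if_card_power_2:
  assumes "CARD('a::{field,finite}) = 2 ^ n"
  shows "(2::'a) = 0"
proof -
  have "(\<Sum>x\<in>UNIV. x + 1) = (\<Sum>x\<in>UNIV. x :: 'a)"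
    by (rule sum.reindex_bij_witness[of _ "\<lambda>x. x - 1" "\<lambda>x. x + 1"]) auto
  then have "of_nat CARD('a) = (0::'a)" by (simp add: sum.distrib)
  then show ?thesis using assms by simp
qed

text \<open>
  Used together with \<open>algebra_simps\<close>, these equations decide polynomial identities in
  characteristic \<open>2\<close>: after sorting, equal monomials are adjacent and cancel in pairs.
\<close>

lemma char_2_simps:
  fixes a b :: "'a::comm_ring_1"
  assumes two: "(2::'a) = 0"
  shows "a + a = 0" "a + (a + b) = b" "- a = a" "a - b = a + b"
    "numeral (num.Bit0 k) = (0::'a)" "numeral (num.Bit1 k) = (1::'a)"
proof -
  have dbl: "x + x = 0" for x :: 'a using two by (metis mult_2 mult_zero_left)
  then show "a + a = 0" .
  show "a + (a + b) = b" using dbl by (simp flip: add.assoc)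
  show neg: "- a = a" for a :: 'a using dbl[of a] by (simp add: minus_unique)
  show "a - b = a + b" using neg[of b] by (metis diff_conv_add_uminus)
  show "numeral (num.Bit0 k) = (0::'a)" "numeral (num.Bit1 k) = (1::'a)"
    by (simp_all only: numeral.simps dbl add_0)
qed

text \<open>
  The map \<open>x \<mapsto> x\<^sup>2 + x\<close> sends \<open>0\<close> and \<open>-1\<close> to the same value, and an injectivity defect of a
  self-map of a finite set is a surjectivity defect. Its non-values take the place of the elements
  of trace \<open>1\<close>.
\<close>

lemma artin_schreier_not_surj:
  obtains t :: "'a::{field,finite}" where "\<And>x. x\<^sup>2 + x \<noteq> t"
proof -
  let ?h = "\<lambda>x::'a. x\<^sup>2 + x"
  have "?h 0 = ?h (-1)" by simp
  then have "\<not> inj ?h"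
    using injD[of ?h 0 "-1"] by auto
  then have "\<not> surj ?h"
    using finite_UNIV_surj_inj[OF finite, of ?h] by blast
  then obtain t where "t \<notin> range ?h" by blast
  then show ?thesis using that[of t] by blast
qed

text \<open>
  The Artin-Schreier map is additive and its fibres are cosets of \<open>{0, 1}\<close>, so its image is a
  subgroup of index \<open>2\<close>. Two elements whose sum lies outside such a subgroup cannot both lie
  outside it.
\<close>

lemma artin_schreier_index_2:
  fixes a b :: "'a::{field,finite}"
  assumes two: "(2::'a) = 0" and ab: "\<And>x. x\<^sup>2 + x \<noteq> a + b"
  obtains (left) x where "x\<^sup>2 + x = a" | (right) x where "x\<^sup>2 + x = b"
proof -
  let ?h = "\<lambda>x::'a. x\<^sup>2 + x"
  let ?P = "range ?h"
  let ?Q = "(\<lambda>y. (a + b) + y) ` ?P"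
  note char2 = char_2_simps[OF two]
  \<comment> \<open>A chosen preimage and an offset in the kernel \<open>{0, 1}\<close> determine each element, which bounds
    the size of the image from below.\<close>
  have "UNIV \<subseteq> (\<lambda>(y, e). inv ?h y + e) ` (?P \<times> {0, 1})"
  proof
    fix x
    define z where "z = inv ?h (?h x)"
    have z: "?h z = ?h x" unfolding z_def by (rule f_inv_into_f) simp
    have "(x - z) * (x - z - 1) = ?h x + ?h z"
      by (simp add: power2_eq_square algebra_simps char2)
    also have "\<dots> = 0" by (simp add: z char2)
    finally have "x - z = 0 \<or> x - z = 1" by simp
    then have "x = z + 0 \<or> x = z + 1" by (auto simp: diff_eq_eq add.commute)
    moreover have "?h x \<in> ?P" by simp
    ultimately show "x \<in> (\<lambda>(y, e). inv ?h y + e) ` (?P \<times> {0, 1})"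
      unfolding z_def by force
  qed
  then have "CARD('a) \<le> card (?P \<times> {0, 1::'a})" by (rule surj_card_le[rotated]) simp
  then have "CARD('a) \<le> 2 * card ?P" by (simp add: card_cartesian_product mult.commute)
  moreover have "?P \<inter> ?Q = {}"
  proof (rule ccontr)
    assume "?P \<inter> ?Q \<noteq> {}"
    then obtain x y where "?h x = (a + b) + ?h y" by blast
    moreover have "?h (x + y) = ?h x + ?h y"
      by (simp add: power2_eq_square algebra_simps char2)
    ultimately have "?h (x + y) = a + b" by (simp add: add.assoc char2)
    then show False using ab by blast
  qed
  moreover have "card ?Q = card ?P" by (rule card_image) simp
  ultimately have "card (?P \<union> ?Q) \<ge> CARD('a)" by (subst card_Un_disjoint) auto
  then have U: "?P \<union> ?Q = UNIV" by (intro card_seteq) auto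
  show ?thesis
  proof (cases "a \<in> ?P")
    case True then show ?thesis using left by blast
  next
    case False
    then have "a \<in> ?Q" using U by blast
    then obtain y where "a = (a + b) + ?h y" by blast
    then have "b + a = b + ((a + b) + ?h y)" by simp
    then have "?h y = b" by (simp add: ac_simps char2)
    then show ?thesis by (rule right)
  qed
qed

section \<open>Identities for the second and third iterates\<close>

text \<open>
  Read with \<open>B = 1/t\<close> and \<open>X\<close> the indeterminate, the left-hand side is the second iterate of
  \<open>f = (x\<^sup>2 + x + w) / t\<close>. Up to a constant factor and an additive constant it equals \<open>h\<^sup>2 + t * h\<close> with \<open>h = x\<^sup>2 + x\<close>,
  which is additive with kernel \<open>{0, 1, s, s + 1}\<close>. Multiplying the factors of two roots that
  differ by \<open>s\<close> gives a quadratic \<open>x\<^sup>2 + s * x + v\<close>. Comparing coefficients, the two constant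
  terms have sum \<open>s + 1\<close> and product \<open>w\<^sup>2 + t * w + t\<^sup>2 * w\<close>. Then \<open>v / (s + 1)\<close> satisfies an
  Artin-Schreier equation; subtracting \<open>w / (s + 1)\<close> from it turns that equation into the one
  for \<open>R\<close>.
\<close>

lemma second_iterate_factorization:
  fixes X B T S W R V Z :: "'a::idom"
  assumes two: "(2::'a) = 0" and tb: "T * B = 1" and t: "T = S\<^sup>2 + S" and r: "R\<^sup>2 + R = W + W * S\<^sup>2"
   and v: "V = W + (S + 1) * R" and z: "Z = B * (X\<^sup>2 + X) + W * B"
  shows "B * (Z\<^sup>2 + Z) + W * B = B ^ 3 * (X\<^sup>2 + S * X + V) * (X\<^sup>2 + S * X + V + S + 1)"
proof -
  define U where "U = X\<^sup>2 + X + W"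
  note char2 = char_2_simps[OF two]
  have rr: "R * R = R + W + W * (S * S)"
  proof -
    have "R * R = (R\<^sup>2 + R) + R" by (simp add: power2_eq_square char2 ac_simps)
    then show ?thesis unfolding r by (simp add: power2_eq_square ac_simps)
  qed
  \<comment> \<open>The second form is needed because simplification keeps products nested to the right.\<close>
  have rr': "R * (R * x) = (R + W + W * (S * S)) * x" for x
    by (simp only: mult.assoc[symmetric] rr)
  have "B * (Z\<^sup>2 + Z) + W * B = B ^ 3 * (U\<^sup>2 + T * U + T\<^sup>2 * W)"
    using tb z unfolding U_def by algebra
  also have "U\<^sup>2 + T * U + T\<^sup>2 * W = (X\<^sup>2 + S * X + V) * (X\<^sup>2 + S * X + V + S + 1)"
    unfolding U_def t v
    by (simp add: power2_eq_square algebra_simps char2 rr rr')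
  finally show ?thesis by (simp add: mult.assoc)
qed

text \<open>
  For \<open>w = t\<close> the second iterate of \<open>f\<close> is quadratic in \<open>Y = x\<^sup>2 + x\<close> and involves only \<open>t\<close>.
  This form serves both for its irreducibility and for computing the third iterate.
\<close>

lemma second_iterate_normal_form:
  fixes Y B T Z :: "'a::idom"
  assumes two: "(2::'a) = 0" and tb: "T * B = 1"
    and z: "Z = B * Y + 1"
  shows "B * (Z\<^sup>2 + Z) + 1 = B ^ 3 * (Y\<^sup>2 + T * Y + T ^ 3)"
proof -
  \<comment> \<open>Modulo \<open>T * B = 1\<close> alone the two sides differ by an even term.\<close>
  have "B * (Z\<^sup>2 + Z) + 1 = B ^ 3 * (Y\<^sup>2 + T * Y + T ^ 3) + 2 * (B\<^sup>2 * Y + B)"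
    using tb z by algebra
  then show ?thesis using two by simp
qed

text \<open>
  The third iterate of \<open>f = (x\<^sup>2 + x + t) / t\<close> is invariant under \<open>x \<mapsto> x + 1\<close>, and the two
  quartic factors are exchanged by this substitution: \<open>D + Y + M\<close> is \<open>D\<close> with \<open>X + 1\<close> in place
  of \<open>X\<close>. Their product is thus a polynomial in \<open>Y\<close>, to be matched with
  \<open>Y\<^sup>4 + (t\<^sup>2 + t\<^sup>3) * Y\<^sup>2 + t\<^sup>4 * Y + t\<^sup>7\<close>. The first two coefficients give the equations
  for \<open>P\<close> and \<open>R\<close>; inserting them into the constant term leaves
  \<open>m\<^sup>4 + (t\<^sup>2 + t\<^sup>3) * m\<^sup>2 + t\<^sup>4 * m + t\<^sup>8 = t\<^sup>7\<close>, of which \<open>t\<^sup>2\<close> and \<open>t\<^sup>2 + t\<close> are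
  solutions.
\<close>

lemma third_iterate_factorization:
  fixes X B T M P R Y Z Z' D:: "'a::idom"
  assumes two: "(2::'a) = 0" and tb: "T * B = 1" and p: "P\<^sup>2 + P = M + T\<^sup>2 + T^3"
    and m: "M = T\<^sup>2 \<or> M = T\<^sup>2 + T"
    and r: "R = T^4 + M * P + M\<^sup>2"
    and y: "Y = X\<^sup>2 + X"
    and z: "Z = B * Y + 1" and z': "Z' = B * (Z\<^sup>2 + Z) + 1"
    and D: "D = Y\<^sup>2 + P * Y + R + X * (Y + M)"
  shows "B * (Z'\<^sup>2 + Z') + 1 = B ^ 7 * D * (D + Y + M)"
proof -
  define U where "U = Y\<^sup>2 + T * Y + T ^ 3"
  note char2 = char_2_simps[OF two]
  have pp: "P * P = P + M + T\<^sup>2 + T^3"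
  proof -
    have "P * P = (P\<^sup>2 + P) + P" by (simp add: power2_eq_square char2 ac_simps)
    then show ?thesis unfolding p by (simp add: ac_simps)
  qed
  have pp': "P * (P * x) = (P + M + T\<^sup>2 + T^3) * x" for x
    by (simp only: mult.assoc[symmetric] pp)
  have xx: "X * X = X + Y"
    using y by (simp add: power2_eq_square char2 ac_simps)
  have xx': "X * (X * a) = (X + Y) * a" for a
    by (simp only: mult.assoc[symmetric] xx)
  have "Z' = B^3 * U" unfolding U_def z' using two tb z by (rule second_iterate_normal_form)
  then have "B * (Z'\<^sup>2 + Z') + 1 = B ^ 7 * (U\<^sup>2 + T^3 * U + T^7)"
    using tb by algebra
  also have "U\<^sup>2 + T^3 * U + T^7 = Y^4 + (T\<^sup>2 + T^3) * Y\<^sup>2 + T^4 * Y + T^7"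
    unfolding U_def by (simp add: eval_nat_numeral algebra_simps char2)
  also have "T\<^sup>2 + T^3 = P\<^sup>2 + P + M" unfolding p by (simp add: char2 ac_simps)
  also have "T ^ 4 = R + M * P + M\<^sup>2" unfolding r by (simp add: char2 ac_simps)
  also have "T ^ 7 = R * (R + M)"
    unfolding r using m by (auto simp: eval_nat_numeral algebra_simps char2 pp pp')
  also have "Y^4 + (P\<^sup>2 + P + M) * Y\<^sup>2 + (R + M * P + M\<^sup>2) * Y + R * (R + M) = D * (D + Y + M)"
    unfolding D by (simp add: eval_nat_numeral algebra_simps char2 xx xx')
  finally show ?thesis by (simp add: mult.assoc)
qed

section \<open>Irreducibility of the iterates\<close>

lemma poly_iterate_quadratic_Suc:
  fixes b e :: "'a::field"
  shows "poly_iterate [:e, b, b:] (Suc k) =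
    [:b:] * ((poly_iterate [:e, b, b:] k)\<^sup>2 + poly_iterate [:e, b, b:] k) + [:e:]"
  by (simp add: pcompose_pCons power2_eq_square algebra_simps)

lemma poly_iterate_1: "poly_iterate f (Suc 0) = f"
  by (simp add: pcompose_idR)

lemma irreducible_artin_schreier_quadratic:
  fixes t e :: "'a::field"
  assumes "t \<noteq> 0" and "\<And>x. x\<^sup>2 + x \<noteq> - (e * t)"
  shows "irreducible [:e, inverse t, inverse t:]"
proof (rule irreducible_quadratic)
  fix x
  show "poly [:e, inverse t, inverse t:] x \<noteq> 0"
  proof
    assume "poly [:e, inverse t, inverse t:] x = 0"
    then have "x\<^sup>2 + x = - (e * t)" using assms(1) by (simp add: field_simps) algebra
    then show False using assms(2) by blast
  qed
qed (simp add: assms(1))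

lemma not_irreducible_mult:
  fixes p q :: "'a::field poly"
  assumes "degree p > 0" "degree q > 0"
  shows "\<not> irreducible (p * q)"
proof
  assume "irreducible (p * q)"
  then have "p dvd 1 \<or> q dvd 1" by (rule irreducibleD) simp
  moreover have "p \<noteq> 0" "q \<noteq> 0" using assms by auto
  ultimately show False using assms by (simp add: is_unit_iff_degree)
qed

lemma const_poly_power: "[:c:] ^ n = [:c ^ n:]"
  by (induction n) (simp_all add: mult.commute)

lemma two_poly_eq_0: "(2::'a::comm_ring_1) = 0 \<Longrightarrow> (2::'a poly) = 0"
  by (simp add: numeral_poly)

lemma second_iterate_reducible:
  fixes s w \<rho> :: "'a::field"
  assumes two: "(2::'a) = 0" and t: "t = s\<^sup>2 + s" and t0: "t \<noteq> 0"
    and \<rho>: "\<rho>\<^sup>2 + \<rho> = w + w * s\<^sup>2"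
  shows "\<not> irreducible (poly_iterate [:w * inverse t, inverse t, inverse t:] 2)"
proof -
  define b where "b = inverse t"
  define v where "v = w + (s + 1) * \<rho>"
  define X :: "'a poly" where "X = [:0, 1:]"
  have b0: "b \<noteq> 0" using t0 by (simp add: b_def)
  have "poly_iterate [:w * b, b, b:] 2 =
      [:b:] ^ 3 * (X\<^sup>2 + [:s:] * X + [:v:]) * (X\<^sup>2 + [:s:] * X + [:v:] + [:s:] + 1)"
  proof -
    define Z where "Z = [:b:] * (X\<^sup>2 + X) + [:w:] * [:b:]"
    have "poly_iterate [:w * b, b, b:] 2 = [:b:] * (Z\<^sup>2 + Z) + [:w:] * [:b:]"
      by (simp add: numeral_2_eq_2 poly_iterate_quadratic_Suc Z_def X_def mult.commute
          del: poly_iterate.simps(2))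
    also have "\<dots> = [:b:] ^ 3 * (X\<^sup>2 + [:s:] * X + [:v:]) * (X\<^sup>2 + [:s:] * X + [:v:] + [:s:] + 1)"
    proof (rule second_iterate_factorization[OF two_poly_eq_0[OF two] _ _ _ _ Z_def,
          where T = "[:t:]" and R = "[:\<rho>:]"])
      show "[:t:] * [:b:] = 1" using t0 by (simp add: b_def)
      show "[:t:] = [:s:]\<^sup>2 + [:s:]" by (simp add: t const_poly_power)
      show "[:\<rho>:]\<^sup>2 + [:\<rho>:] = [:w:] + [:w:] * [:s:]\<^sup>2" using \<rho> by (simp add: const_poly_power)
      show "[:v:] = [:w:] + ([:s:] + 1) * [:\<rho>:]" by (simp add: v_def one_pCons)
    qed
    finally show ?thesis .
  qed
  also have "\<dots> = [:b ^ 3 * v, b ^ 3 * s, b ^ 3:] * [:v + s + 1, s, 1:]"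
    by (simp add: X_def const_poly_power power2_eq_square one_pCons)
  finally show ?thesis
    unfolding b_def[symmetric] using b0 by (simp add: not_irreducible_mult del: mult_pCons_left mult_pCons_right)
qed

text \<open>
  A quadratic factor \<open>x\<^sup>2 + u * x + v\<close> of the normalised quartic needs \<open>u = 1\<close> or
  \<open>u\<^sup>2 + u = t\<close>. The latter is excluded, and for \<open>u = 1\<close> the constant terms are roots of
  \<open>x\<^sup>2 + t * x + t\<^sup>3\<close>, which after scaling by \<open>t\<close> is again \<open>x\<^sup>2 + x = t\<close>. A root of the quartic
  would also yield a root of this quadratic.
\<close>

lemma second_iterate_irreducible:
  fixes t :: "'a::field"
  assumes two: "(2::'a) = 0" and t: "\<And>x. x\<^sup>2 + x \<noteq> t"
  shows "irreducible (poly_iterate [:1, inverse t, inverse t:] 2)"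
proof -
  define b where "b = inverse t"
  define X :: "'a poly" where "X = [:0, 1:]"
  note char2 = char_2_simps[OF two]
  have t0: "t \<noteq> 0" using t[of 0] by auto
  then have b0: "b \<noteq> 0" by (simp add: b_def)
  define Q where "Q = [:t ^ 3, t, 1 + t, 0, 1:]"
  have it: "poly_iterate [:1, b, b:] 2 = smult (b ^ 3) Q"
  proof -
    define Z where "Z = [:b:] * (X\<^sup>2 + X) + 1"
    have "poly_iterate [:1, b, b:] 2 = [:b:] * (Z\<^sup>2 + Z) + 1"
      by (simp add: numeral_2_eq_2 poly_iterate_quadratic_Suc Z_def X_def one_pCons
          del: poly_iterate.simps(2))
    also have "\<dots> = [:b:] ^ 3 * ((X\<^sup>2 + X)\<^sup>2 + [:t:] * (X\<^sup>2 + X) + [:t:] ^ 3)"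
      using t0 by (intro second_iterate_normal_form[OF two_poly_eq_0[OF two] _ Z_def]) (simp add: b_def)
    also have "\<dots> = smult (b ^ 3) Q"
      by (simp add: X_def Q_def const_poly_power power2_eq_square char2)
    finally show ?thesis .
  qed
  have nofac: "\<not> (\<exists>x. x\<^sup>2 + t * x + t ^ 3 = 0)"
  proof
    assume "\<exists>x. x\<^sup>2 + t * x + t ^ 3 = 0"
    then obtain x where "x\<^sup>2 + t * x + t ^ 3 = 0" by blast
    then have "(x / t)\<^sup>2 + x / t = - t"
      using t0 by (simp add: field_simps power2_eq_square eval_nat_numeral) algebra
    then show False using t by (simp add: char2)
  qed
  have "irreducible Q"
    unfolding Q_def
  proof (rule irreducible_depressed_quartic)
    fix x
    show "poly [:t ^ 3, t, 1 + t, 0, 1:] x \<noteq> 0"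
    proof
      assume "poly [:t ^ 3, t, 1 + t, 0, 1:] x = 0"
      then have "(x\<^sup>2 + x)\<^sup>2 + t * (x\<^sup>2 + x) + t ^ 3 = 0"
        by (simp add: power2_eq_square algebra_simps char2)
      then show False using nofac by blast
    qed
  next
    fix u v w
    show "[:t ^ 3, t, 1 + t, 0, 1:] \<noteq> [:v, u, 1:] * [:w, - u, 1:]"
    proof
      assume "[:t ^ 3, t, 1 + t, 0, 1:] = [:v, u, 1:] * [:w, - u, 1:]"
      then have c: "coeff [:t ^ 3, t, 1 + t, 0, 1:] k = coeff ([:v, u, 1:] * [:w, - u, 1:]) k" for k
        by (rule arg_cong)
      have c0: "v * w = t ^ 3" using c[of 0] by simp
      have c1: "u * (v + w) = t" using c[of 1] by (simp add: char2 algebra_simps)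
      have c2: "v + w + u\<^sup>2 = 1 + t"
        using c[of 2] by (simp add: char2 numeral_2_eq_2 algebra_simps)
      have vw: "v + w = 1 + t + u\<^sup>2"
        by (simp flip: c2 add: char2 add.assoc)
      have "(u + 1) * (u\<^sup>2 + u + t) = u * (v + w) + t"
        unfolding vw by (simp add: power2_eq_square algebra_simps char2)
      also have "\<dots> = 0" by (simp add: c1 char2)
      finally have "u + 1 = 0 \<or> u\<^sup>2 + u + t = 0" by simp
      then have "u = 1" using t[of u] by (auto simp: add_eq_0_iff2 char2)
      then have "w = t + v" using c1 by (auto simp: char2 ac_simps)
      then have "v\<^sup>2 + t * v + t ^ 3 = 0"
        unfolding c0[symmetric] \<open>w = t + v\<close> by (simp add: power2_eq_square algebra_simps char2)
      then show False using nofac by blast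
    qed
  qed
  then show ?thesis unfolding b_def[symmetric] it
    using b0 irreducible_mult_unit_left[of "[:b ^ 3:]" Q] by (simp add: is_unit_const_poly_iff dvd_field_iff)
qed

lemma third_iterate_reducible:
  fixes t m p :: "'a::field"
  assumes two: "(2::'a) = 0" and t0: "t \<noteq> 0"
    and m: "m = t\<^sup>2 \<or> m = t\<^sup>2 + t" and p: "p\<^sup>2 + p = m + t\<^sup>2 + t ^ 3"
  shows "\<not> irreducible (poly_iterate [:1, inverse t, inverse t:] 3)"
proof -
  define b where "b = inverse t"
  define r where "r = t ^ 4 + m * p + m\<^sup>2"
  define X :: "'a poly" where "X = [:0, 1:]"
  define Y where "Y = X\<^sup>2 + X"
  define D where "D = Y\<^sup>2 + [:p:] * Y + [:r:] + X * (Y + [:m:])"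
  note char2 = char_2_simps[OF two]
  have b0: "b \<noteq> 0" using t0 by (simp add: b_def)
  have "poly_iterate [:1, b, b:] 3 = [:b:] ^ 7 * D * (D + Y + [:m:])"
  proof -
    define Z where "Z = [:b:] * Y + 1"
    define Z' where "Z' = [:b:] * (Z\<^sup>2 + Z) + 1"
    have "poly_iterate [:1, b, b:] 3 = [:b:] * (Z'\<^sup>2 + Z') + 1"
      by (simp add: numeral_3_eq_3 poly_iterate_quadratic_Suc Z_def Z'_def X_def Y_def one_pCons
          del: poly_iterate.simps(2))
    also have "\<dots> = [:b:] ^ 7 * D * (D + Y + [:m:])"
    proof (rule third_iterate_factorization[OF two_poly_eq_0[OF two] _ _ _ _ Y_def Z_def Z'_def D_def,
          where T = "[:t:]"])
      show "[:t:] * [:b:] = 1" using t0 by (simp add: b_def)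
      show "[:p:]\<^sup>2 + [:p:] = [:m:] + [:t:]\<^sup>2 + [:t:] ^ 3" using p by (simp add: const_poly_power)
      show "[:m:] = [:t:]\<^sup>2 \<or> [:m:] = [:t:]\<^sup>2 + [:t:]" using m by (simp add: const_poly_power)
      show "[:r:] = [:t:] ^ 4 + [:m:] * [:p:] + [:m:]\<^sup>2" by (simp add: const_poly_power r_def)
    qed
    finally show ?thesis .
  qed
  also have "\<dots> = smult (b ^ 7) [:r, p + m, p, 1, 1:] * [:r + m, p + m + 1, p + 1, 1, 1:]"
  proof -
    have "D = [:r, p + m, p, 1, 1:]"
      by (simp add: D_def Y_def X_def power2_eq_square char2 ac_simps)
    then show ?thesis by (simp add: const_poly_power Y_def X_def power2_eq_square ac_simps)
  qed
  finally show ?thesis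
    unfolding b_def[symmetric] using b0 by (simp add: not_irreducible_mult del: mult_pCons_left mult_pCons_right)
qed

section \<open>Newly reducible iterates\<close>

lemma newly_reducible_class_2_2:
  assumes two: "(2::'a::{field,finite}) = 0" and card: "CARD('a) > 2"
  shows "newly_reducible_class TYPE('a) 2 2"
proof -
  note char2 = char_2_simps[OF two]
  obtain w :: 'a where w: "\<And>x. x\<^sup>2 + x \<noteq> w" using artin_schreier_not_surj by blast
  have "card {0, 1::'a} < CARD('a)" using card by simp
  then obtain s :: 'a where s: "s \<notin> {0, 1}" by (metis UNIV_eq_I nat_less_le)
  define t where "t = s\<^sup>2 + s"
  have "t = s * (s + 1)" by (simp add: t_def power2_eq_square algebra_simps)
  then have t0: "t \<noteq> 0" using s by (auto simp: add_eq_0_iff2 char2)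
  \<comment> \<open>Replacing \<open>s\<close> by \<open>s + 1\<close> preserves \<open>t\<close> and changes \<open>w + w * s\<^sup>2\<close> by the non-value \<open>w\<close>,
    so one of the two choices makes it a value of the Artin-Schreier map.\<close>
  obtain s' \<rho> where s': "t = s'\<^sup>2 + s'" and \<rho>: "\<rho>\<^sup>2 + \<rho> = w + w * s'\<^sup>2"
  proof (rule artin_schreier_index_2[OF two, of "w + w * s\<^sup>2" "w * s\<^sup>2"])
    show "x\<^sup>2 + x \<noteq> w + w * s\<^sup>2 + w * s\<^sup>2" for x using w by (simp add: add.assoc char2)
  next
    fix x assume "x\<^sup>2 + x = w + w * s\<^sup>2"
    then show thesis using that[of s x] by (simp add: t_def)
  next
    fix x assume "x\<^sup>2 + x = w * s\<^sup>2"
    then show thesis using that[of "s + 1" x]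
      by (simp add: t_def power2_eq_square algebra_simps char2)
  qed
  let ?f = "[:w * inverse t, inverse t, inverse t:]"
  have "irreducible ?f"
    using t0 w by (intro irreducible_artin_schreier_quadratic) (auto simp: char2 mult.assoc)
  moreover have "\<not> irreducible (poly_iterate ?f 2)"
    using two s' t0 \<rho> by (rule second_iterate_reducible)
  ultimately have "newly_reducible_iterate 2 ?f"
    by (simp add: newly_reducible_iterate_def poly_iterate_1 del: poly_iterate.simps)
  then show ?thesis
    unfolding newly_reducible_class_def using t0 by (intro exI[of _ ?f]) simp
qed

lemma newly_reducible_class_2_3:
  assumes two: "(2::'a::{field,finite}) = 0"
  shows "newly_reducible_class TYPE('a) 2 3"
proof -
  note char2 = char_2_simps[OF two]
  obtain t :: 'a where t: "\<And>x. x\<^sup>2 + x \<noteq> t" using artin_schreier_not_surj by blast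
  have t0: "t \<noteq> 0" using t[of 0] by auto
  \<comment> \<open>The right-hand sides for the two possible values of \<open>m\<close> differ by the non-value \<open>t\<close>.\<close>
  obtain m p where m: "m = t\<^sup>2 \<or> m = t\<^sup>2 + t" and p: "p\<^sup>2 + p = m + t\<^sup>2 + t ^ 3"
  proof (rule artin_schreier_index_2[OF two, of "t ^ 3" "t + t ^ 3"])
    show "x\<^sup>2 + x \<noteq> t ^ 3 + (t + t ^ 3)" for x using t by (simp add: ac_simps char2)
  next
    fix x assume "x\<^sup>2 + x = t ^ 3"
    then show thesis using that[of "t\<^sup>2" x] by (simp add: char2)
  next
    fix x assume "x\<^sup>2 + x = t + t ^ 3"
    then show thesis using that[of "t\<^sup>2 + t" x] by (simp add: char2 ac_simps)
  qed
  let ?f = "[:1, inverse t, inverse t:]"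
  have "irreducible (poly_iterate ?f 2)"
    using two t by (rule second_iterate_irreducible)
  moreover have "\<not> irreducible (poly_iterate ?f 3)"
    using two t0 m p by (rule third_iterate_reducible)
  ultimately have "newly_reducible_iterate 3 ?f"
    by (simp add: newly_reducible_iterate_def del: poly_iterate.simps)
  then show ?thesis
    unfolding newly_reducible_class_def using t0 by (intro exI[of _ ?f]) simp
qed

theorem proposition3p4:
  fixes n :: nat
  assumes "CARD('a::{field,finite}) = 2 ^ n"
  shows "(n \<ge> 2 \<longrightarrow> newly_reducible_class TYPE('a) 2 2) \<and>
         (n \<ge> 1 \<longrightarrow> newly_reducible_class TYPE('a) 2 3)"
proof -
  have two: "(2::'a) = 0" using assms by (rule two_eq_0_if_card_power_2)
  have "CARD('a) > 2" if "n \<ge> 2"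
    using power_increasing[OF that, of "2::nat"] assms by simp
  then show ?thesis
    using newly_reducible_class_2_2[OF two] newly_reducible_class_2_3[OF two] by blast
qed

end
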